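(* Assume that $\epsilon\le \beta\min_{i\in A^*}|x_i^*|$ for some $0\le\beta<1/2$, and that $\nu<\frac{1-2\beta}{2T-1}$. Then for any $\rho\in\left(((2T-1)\nu+2\beta)^2,\,1\right)$, the PDASC algorithm (run with decreasing factor $\rho$) converges in finitely many steps, i.e., its outer stopping criterion $\|\Psi x(\lambda_k)-y\|\le\epsilon$ is satisfied for some finite $k$.
   Context: Setting: $\Psi\in\mathbb{R}^{n\times p}$, $p>n$, is a real matrix whose columns $\psi_1,\dots,\psi_p$ are normalized, $\|\psi_i\|=1$ (here $\|\cdot\|$ is the Euclidean norm). The true signal $x^*\in\mathbb{R}^p$ has support $A^*=\{i:x_i^*\ne0\}$ with $T=|A^*|\ge1$. The data are $y=\sum_{i\in A^*}x_i^*\psi_i+\eta\in\mathbb{R}^n$, where the noise $\eta\in\mathbb{R}^n$ satisfies $\|\eta\|\le\epsilon$ with noise level $\epsilon\ge0$. For an index set $A\subseteq\{1,\dots,p\}$, $\Psi_A$ is the submatrix of $\Psi$ with columns indexed by $A$, and $x_A$ is the subvector of $x$ indexed by $A$. Mutual coherence: $\nu=\max_{i\ne j}|\psi_i^t\psi_j|$. PDASC algorithm (primal dual active set with continuation). Inputs: $\Psi,y,\epsilon$, any $\lambda_0\ge\frac12\|\Psi^ty\|_{\ell^\infty}^2$, a decreasing factor $\rho\in(0,1)$, and an integer $J_{max}\ge1$. Initialize $A(\lambda_0)=\emptyset$, $x(\lambda_0)=0$, $d(\lambda_0)=\Psi^ty$. For $k=1,2,\dots$: 1. Set $\lambda_k=\rho\lambda_{k-1}$,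 $A_0=A(\lambda_{k-1})$, $(x^0,d^0)=(x(\lambda_{k-1}),d(\lambda_{k-1}))$. 2. Inner loop, for $j=1,2,\dots,J_{max}$: set $A_j=\{i:|x_i^{j-1}+d_i^{j-1}|>\sqrt{2\lambda_k}\}$ and $I_j=\{1,\dots,p\}\setminus A_j$; define $x^j$ by $x^j_{I_j}=0$ and $\Psi_{A_j}^t\Psi_{A_j}x^j_{A_j}=\Psi_{A_j}^ty$, and $d^j=\Psi^t(y-\Psi x^j)$; leave the inner loop if $A_j=A_{j-1}$. 3. Let $\widetilde j\le J_{max}$ be the last inner index reached; set $(x(\lambda_k),d(\lambda_k))=(x^{\widetilde j},d^{\widetilde j})$ and $A(\lambda_k)=\{i:|x_i^{\widetilde j}+d_i^{\widetilde j}|>\sqrt{2\lambda_k}\}$. 4. Stop the algorithm if $\|\Psi x(\lambda_k)-y\|\le\epsilon$. *)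

theory Defs
  imports "HOL-Analysis.Analysis"
begin

definition supp :: "real ^ 'p \<Rightarrow> 'p set" where
  "supp x = {i. x $ i \<noteq> 0}"

definition mutual_coherence :: "real ^ 'p ^ 'n \<Rightarrow> real" where
  "mutual_coherence \<Psi> = Max {\<bar>column i \<Psi> \<bullet> column j \<Psi>\<bar> | i j. i \<noteq> j}"

definition active_set :: "real \<Rightarrow> real ^ 'p \<Rightarrow> real ^ 'p \<Rightarrow> 'p set" where
  "active_set l x d = {i. \<bar>x $ i + d $ i\<bar> > sqrt (2 * l)}"

text \<open>
  The system $\Psi_A^t \Psi_A x_A = \Psi_A^t y$ written entrywise, together with $x = 0$ off $A$.
  It always has a solution, but the solution need not be unique when the columns indexed by $A$ are
  linearly dependent. It is therefore kept as a relation, and a run of the algorithm may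
  pick any solution.
\<close>
definition restricted_normal_eq ::
  "real ^ 'p ^ 'n \<Rightarrow> real ^ 'n \<Rightarrow> 'p set \<Rightarrow> real ^ 'p \<Rightarrow> bool" where
  "restricted_normal_eq \<Psi> y A x \<longleftrightarrow>
     (\<forall>i\<in>-A. x $ i = 0) \<and>
     (\<forall>i\<in>A. (\<Sum>j\<in>A. (column i \<Psi> \<bullet> column j \<Psi>) * x $ j) = column i \<Psi> \<bullet> y)"

text \<open>
  \<open>(x, d)\<close> is a possible result of the inner loop at level \<open>l\<close> with at most \<open>J\<close> iterations,
  started from \<open>(A0, x0, d0)\<close>; \<open>m\<close> is the last inner index reached.
\<close>
definition inner_loop ::
  "real ^ 'p ^ 'n \<Rightarrow> real ^ 'n \<Rightarrow> real \<Rightarrow> nat \<Rightarrow>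
   'p set \<Rightarrow> real ^ 'p \<Rightarrow> real ^ 'p \<Rightarrow> real ^ 'p \<Rightarrow> real ^ 'p \<Rightarrow> bool" where
  "inner_loop \<Psi> y l J A0 x0 d0 x d \<longleftrightarrow>
     (\<exists>m As xs ds.
        1 \<le> m \<and> m \<le> J \<and>
        As 0 = A0 \<and> xs 0 = x0 \<and> ds 0 = d0 \<and>
        (\<forall>j\<in>{1..m}.
           As j = active_set l (xs (j - 1)) (ds (j - 1)) \<and>
           restricted_normal_eq \<Psi> y (As j) (xs j) \<and>
           ds j = transpose \<Psi> *v (y - \<Psi> *v xs j)) \<and>
        (\<forall>j\<in>{1..<m}. As j \<noteq> As (j - 1)) \<and>
        (m = J \<or> As m = As (m - 1)) \<and>
        x = xs m \<and> d = ds m)"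

definition pdasc_stop :: "real ^ 'p ^ 'n \<Rightarrow> real ^ 'n \<Rightarrow> real \<Rightarrow> real ^ 'p \<Rightarrow> bool" where
  "pdasc_stop \<Psi> y \<epsilon> x \<longleftrightarrow> norm (\<Psi> *v x - y) \<le> \<epsilon>"

text \<open>
  The sequences describe a run of the algorithm: \<open>lam k\<close>, \<open>A k\<close>, \<open>x k\<close>, \<open>d k\<close> stand for
  $\lambda_k$, $A(\lambda_k)$, $x(\lambda_k)$, $d(\lambda_k)$. Iteration \<open>k\<close> is carried out only
  if the stopping criterion failed at all iterations \<open>1, \<dots>, k - 1\<close>. It is not tested at the
  initialization \<open>k = 0\<close>. Entries beyond the first stopping index are unconstrained.
\<close>
definition pdasc_run ::
  "real ^ 'p ^ 'n \<Rightarrow> real ^ 'n \<Rightarrow> real \<Rightarrow> real \<Rightarrow> real \<Rightarrow> nat \<Rightarrow>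
   (nat \<Rightarrow> real) \<Rightarrow> (nat \<Rightarrow> 'p set) \<Rightarrow> (nat \<Rightarrow> real ^ 'p) \<Rightarrow> (nat \<Rightarrow> real ^ 'p) \<Rightarrow> bool" where
  "pdasc_run \<Psi> y \<epsilon> lam0 \<rho> J lam A x d \<longleftrightarrow>
     lam 0 = lam0 \<and> A 0 = {} \<and> x 0 = 0 \<and> d 0 = transpose \<Psi> *v y \<and>
     (\<forall>k\<ge>1. (\<forall>i\<in>{1..<k}. \<not> pdasc_stop \<Psi> y \<epsilon> (x i)) \<longrightarrow>
        lam k = \<rho> * lam (k - 1) \<and>
        inner_loop \<Psi> y (lam k) J (A (k - 1)) (x (k - 1)) (d (k - 1)) (x k) (d k) \<and>
        A k = active_set (lam k) (x k) (d k))"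

text \<open>The algorithm never gets stuck: every step, and hence a full run, exists for all inputs.\<close>

lemma restricted_normal_eq_exists:
  fixes \<Psi> :: "real ^ 'p ^ 'n"
  shows "\<exists>x. restricted_normal_eq \<Psi> y A x"
proof -
  let ?c = "\<lambda>i. column i \<Psi>"
  have "\<exists>u v. u \<in> span (?c ` A) \<and> (\<forall>w. w \<in> span (?c ` A) \<longrightarrow> orthogonal v w) \<and> y = u + v"
    by (rule orthogonal_subspace_decomp_exists[of "?c ` A" y]) blast
  then obtain u v where u: "u \<in> span (?c ` A)"
    and v: "\<And>w. w \<in> span (?c ` A) \<Longrightarrow> orthogonal v w" and y: "y = u + v"
    by blast
  have "\<exists>r. u = (\<Sum>j\<in>A. r j *\<^sub>R ?c j)"
    using u
  proof (induction rule: span_induct_alt)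
    case base
    show ?case by (rule exI[of _ "\<lambda>_. 0"]) simp
  next
    case (step c w z)
    then obtain r i where r: "z = (\<Sum>j\<in>A. r j *\<^sub>R ?c j)" and i: "i \<in> A" "w = ?c i"
      by blast
    have "c *\<^sub>R w + z = (\<Sum>j\<in>A. (r j + (if j = i then c else 0)) *\<^sub>R ?c j)"
      using i by (simp add: r scaleR_add_left sum.distrib if_distrib[of "\<lambda>t. t *\<^sub>R _"]
          sum.delta cong: if_cong)
    then show ?case by (rule exI[of _ "\<lambda>j. r j + (if j = i then c else 0)"])
  qed
  then obtain r where r: "u = (\<Sum>j\<in>A. r j *\<^sub>R ?c j)" by blast
  have "(\<Sum>j\<in>A. (?c i \<bullet> ?c j) * r j) = ?c i \<bullet> y" if "i \<in> A" for i
  proof -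
    have "?c i \<bullet> v = 0"
      using v[of "?c i"] that by (simp add: span_base orthogonal_def inner_commute)
    then show ?thesis
      by (simp add: y inner_add_right r inner_sum_right mult.commute)
  qed
  then have "restricted_normal_eq \<Psi> y A (\<chi> j. if j \<in> A then r j else 0)"
    by (simp add: restricted_normal_eq_def)
  then show ?thesis by blast
qed

lemma inner_loop_exists:
  fixes \<Psi> :: "real ^ 'p ^ 'n"
  assumes "1 \<le> J"
  shows "\<exists>x d. inner_loop \<Psi> y l J A0 x0 d0 x d"
proof -
  define step where "step = (\<lambda>(A :: 'p set, x, d).
    let A' = active_set l x d; x' = (SOME x'. restricted_normal_eq \<Psi> y A' x')
    in (A', x', transpose \<Psi> *v (y - \<Psi> *v x')))"
  define s where "s j = (step ^^ j) (A0, x0, d0)" for j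
  define As xs ds where "As j = fst (s j)" and "xs j = fst (snd (s j))" and "ds j = snd (snd (s j))" for j
  have init: "As 0 = A0" "xs 0 = x0" "ds 0 = d0"
    by (simp_all add: As_def xs_def ds_def s_def)
  have stp: "As (Suc j) = active_set l (xs j) (ds j) \<and>
      restricted_normal_eq \<Psi> y (As (Suc j)) (xs (Suc j)) \<and>
      ds (Suc j) = transpose \<Psi> *v (y - \<Psi> *v xs (Suc j))" for j
    using someI_ex[OF restricted_normal_eq_exists, of \<Psi> y "As (Suc j)"]
    by (auto simp add: As_def xs_def ds_def s_def step_def Let_def split: prod.split)
  define P where "P m \<longleftrightarrow> 1 \<le> m \<and> (m = J \<or> As m = As (m - 1))" for m
  define m where "m = (LEAST m. P m)"
  have PJ: "P J" using assms by (simp add: P_def)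
  have m: "P m" "m \<le> J" "\<And>j. j < m \<Longrightarrow> \<not> P j"
    unfolding m_def using PJ by (auto intro: LeastI Least_le dest: not_less_Least)
  have "inner_loop \<Psi> y l J A0 x0 d0 (xs m) (ds m)"
    unfolding inner_loop_def
  proof (intro exI conjI ballI)
    fix j assume "j \<in> {1..m}"
    then obtain i where i: "j = Suc i" by (cases j) auto
    show "As j = active_set l (xs (j - 1)) (ds (j - 1))"
      "restricted_normal_eq \<Psi> y (As j) (xs j)" "ds j = transpose \<Psi> *v (y - \<Psi> *v xs j)"
      using stp[of i] by (metis i diff_Suc_1)+
  next
    fix j assume "j \<in> {1..<m}"
    then show "As j \<noteq> As (j - 1)" using m(3)[of j] by (auto simp: P_def)
  qed (use m init in \<open>auto simp: P_def\<close>)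
  then show ?thesis by blast
qed

lemma pdasc_run_exists:
  fixes \<Psi> :: "real ^ 'p ^ 'n"
  assumes "1 \<le> J"
  shows "\<exists>lam A x d. pdasc_run \<Psi> y \<epsilon> lam0 \<rho> J lam A x d"
proof -
  define lam where "lam k = \<rho> ^ k * lam0" for k
  define step where "step k = (\<lambda>(A :: 'p set, x, d).
    let xd = (SOME xd. inner_loop \<Psi> y (lam (Suc k)) J A x d (fst xd) (snd xd))
    in (active_set (lam (Suc k)) (fst xd) (snd xd), fst xd, snd xd))" for k
  define s where "s = rec_nat ({}, 0, transpose \<Psi> *v y) step"
  define A x d where "A k = fst (s k)" and "x k = fst (snd (s k))" and "d k = snd (snd (s k))" for k
  have ex: "\<exists>xd. inner_loop \<Psi> y l J A' x' d' (fst xd) (snd xd)" for l A' x' d'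
    using inner_loop_exists[OF assms] by simp
  have stp: "inner_loop \<Psi> y (lam (Suc k)) J (A k) (x k) (d k) (x (Suc k)) (d (Suc k)) \<and>
      A (Suc k) = active_set (lam (Suc k)) (x (Suc k)) (d (Suc k))" for k
    using someI_ex[OF ex]
    by (simp add: A_def x_def d_def s_def step_def Let_def split: prod.split)
  have "pdasc_run \<Psi> y \<epsilon> lam0 \<rho> J lam A x d"
    unfolding pdasc_run_def
  proof (intro conjI allI impI)
    fix k :: nat assume "1 \<le> k"
    then obtain i where i: "k = Suc i" by (cases k) auto
    show "lam k = \<rho> * lam (k - 1)" by (simp add: i lam_def)
    show "inner_loop \<Psi> y (lam k) J (A (k - 1)) (x (k - 1)) (d (k - 1)) (x k) (d k)"
      "A k = active_set (lam k) (x k) (d k)"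
      using stp[of i] by (metis i diff_Suc_1)+
  qed (simp_all add: lam_def A_def x_def d_def s_def)
  then show ?thesis by blast
qed

end

theory Submission
  imports Defs
begin

text \<open>
  Let $S$ be the support of $x^*$, $r = \sqrt\rho$, $s = \sqrt{2\lambda}$, $c = (T-1)\nu + \beta$,
  so that $c + (T\nu + \beta) < r$. If $x$ solves the normal equations on $A \subseteq S$ and
  $|x^*_i| \le M$ on $S \setminus A$, where $\epsilon \le \beta M$, then $x + d$ differs from $x^*$
  by at most $cM$ on $S$ and by at most $(T\nu + \beta)M$ off $S$. For $M = s/(r - c)$ the second
  bound is at most $s$, so the new active set stays inside $S$, and by the first bound the entries
  it misses have modulus at most $s + cM = rM$, which is the value of $M$ for the next $\lambda$.
  As $M$ decays geometrically, it eventually drops below $\min_S |x^*|$. The active set of that level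
  is $S$, and least squares on $S$ has residual at most $\|\eta\|$.
\<close>

section \<open>Matrix products by columns, coherence and least squares\<close>

lemma transpose_matrix_vector_nth: "(transpose \<Psi> *v w) $ i = column i \<Psi> \<bullet> (w :: real ^ 'n)"
  by (simp add: matrix_vector_mult_def transpose_def column_def inner_vec_def)

lemma matrix_vector_mult_columns:
  fixes \<Psi> :: "real ^ 'p ^ 'n"
  shows "\<Psi> *v x = (\<Sum>j\<in>UNIV. x $ j *\<^sub>R column j \<Psi>)"
  by (simp add: matrix_mult_sum scalar_mult_eq_scaleR)

lemma matrix_vector_mult_supported:
  fixes \<Psi> :: "real ^ 'p ^ 'n"
  assumes "\<And>i. i \<notin> S \<Longrightarrow> x $ i = 0"
  shows "\<Psi> *v x = (\<Sum>j\<in>S. x $ j *\<^sub>R column j \<Psi>)"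
  unfolding matrix_vector_mult_columns
  by (rule sum.mono_neutral_right) (use assms in auto)

text \<open>As \<open>x\<close> vanishes off \<open>A\<close>, each left-hand sum pairs
  \<open>column i \<Psi>\<close> with \<open>\<Psi> *v x\<close>. The normal equations thus make the
  residual orthogonal to the active columns, that is, the dual variable vanishes on
  \<open>A\<close>.\<close>

lemma restricted_normal_eq_iff:
  "restricted_normal_eq \<Psi> y A x \<longleftrightarrow>
     (\<forall>i. i \<notin> A \<longrightarrow> x $ i = 0) \<and> (\<forall>i\<in>A. column i \<Psi> \<bullet> (y - \<Psi> *v x) = 0)"
proof -
  have "(\<Sum>j\<in>A. (column i \<Psi> \<bullet> column j \<Psi>) * x $ j) = column i \<Psi> \<bullet> (\<Psi> *v x)"
    if "\<forall>i. i \<notin> A \<longrightarrow> x $ i = 0" for i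
    using that
    by (subst matrix_vector_mult_supported[where S = A]) (simp_all add: inner_sum_right mult.commute)
  then show ?thesis
    unfolding restricted_normal_eq_def by (auto simp: inner_diff_right)
qed

lemma abs_inner_columns_le_coherence:
  fixes \<Psi> :: "real ^ 'p ^ 'n"
  assumes "i \<noteq> j"
  shows "\<bar>column i \<Psi> \<bullet> column j \<Psi>\<bar> \<le> mutual_coherence \<Psi>"
  unfolding mutual_coherence_def
proof (rule Max_ge)
  have "{\<bar>column i \<Psi> \<bullet> column j \<Psi>\<bar> | i j. i \<noteq> j} \<subseteq> (\<lambda>(i, j). \<bar>column i \<Psi> \<bullet> column j \<Psi>\<bar>) ` UNIV"
    by auto
  then show "finite {\<bar>column i \<Psi> \<bullet> column j \<Psi>\<bar> | i j. i \<noteq> j}"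
    by (rule finite_subset) simp
qed (use assms in auto)

text \<open>The residual of \<open>x\<close> is orthogonal to the columns in \<open>A\<close>, and
  \<open>\<Psi> *v (x - z)\<close> is a combination of them. Their sum is
  \<open>y - \<Psi> *v z\<close>, so Pythagoras applies.\<close>

lemma least_squares_residual_le:
  fixes \<Psi> :: "real ^ 'p ^ 'n"
  assumes "restricted_normal_eq \<Psi> y A x" and "supp z \<subseteq> A"
  shows "norm (\<Psi> *v x - y) \<le> norm (y - \<Psi> *v z)"
proof -
  let ?r = "y - \<Psi> *v x"
  have "x $ i - z $ i = 0" if "i \<notin> A" for i
    using assms that by (auto simp: restricted_normal_eq_iff supp_def)
  then have "?r \<bullet> (\<Psi> *v (x - z)) = (\<Sum>j\<in>A. (x $ j - z $ j) * (column j \<Psi> \<bullet> ?r))"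
    by (subst matrix_vector_mult_supported[where S = A])
      (simp_all add: inner_sum_right inner_commute)
  also have "\<dots> = 0"
    using assms by (simp add: restricted_normal_eq_iff)
  finally have "?r \<bullet> (\<Psi> *v (x - z)) = 0" .
  then have "norm (?r + \<Psi> *v (x - z)) ^ 2 = norm ?r ^ 2 + norm (\<Psi> *v (x - z)) ^ 2"
    by (simp add: power2_norm_eq_inner inner_add_left inner_add_right inner_commute)
  then have "norm ?r ^ 2 \<le> norm (?r + \<Psi> *v (x - z)) ^ 2"
    by simp
  then have "norm ?r \<le> norm (?r + \<Psi> *v (x - z))"
    by (rule power2_le_imp_le) simp
  then show ?thesis
    by (simp add: matrix_vector_mult_diff_distrib norm_minus_commute)
qed

section \<open>Error of one primal-dual pair under small coherence\<close>

locale coherent_recovery =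
  fixes \<Psi> :: "real ^ 'p ^ 'n" and z :: "real ^ 'p" and y :: "real ^ 'n" and \<epsilon> \<beta> :: real
  assumes card_gt_1: "CARD('p) > 1"
    and norm_column: "norm (column i \<Psi>) = 1"
    and noise: "norm (y - \<Psi> *v z) \<le> \<epsilon>"
    and \<beta>_nonneg: "0 \<le> \<beta>"
    and small: "(2 * real (card (supp z)) - 1) * mutual_coherence \<Psi> + 2 * \<beta> < 1"
    and supp_nonempty: "supp z \<noteq> {}"
begin

abbreviation "\<nu> \<equiv> mutual_coherence \<Psi>"
abbreviation "T \<equiv> real (card (supp z))"

text \<open>Interference plus noise, relative to the size of the error: a support column meets
  \<open>T - 1\<close> other support columns, a column off the support meets all
  \<open>T\<close>.\<close>

definition "c_on = (T - 1) * \<nu> + \<beta>"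
definition "c_off = T * \<nu> + \<beta>"

text \<open>With at least two columns the maximum ranges over a nonempty set of absolute
  values.\<close>

lemma coherence_nonneg: "0 \<le> \<nu>"
proof -
  obtain i j :: 'p where "i \<noteq> j"
    using card_gt_1 by (metis (full_types) One_nat_def UNIV_I card_le_Suc0_iff_eq finite leD)
  from abs_inner_columns_le_coherence[OF this, of \<Psi>] show ?thesis by linarith
qed

lemma T_ge_1: "1 \<le> T"
  using supp_nonempty by (simp add: Suc_le_eq card_gt_0_iff)

lemma constants:
  shows "c_on + c_off = (2 * T - 1) * \<nu> + 2 * \<beta>" and "0 \<le> c_on" and "0 \<le> c_off" and "c_on < 1"
proof -
  show eq: "c_on + c_off = (2 * T - 1) * \<nu> + 2 * \<beta>"
    by (simp add: c_on_def c_off_def algebra_simps)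
  show on: "0 \<le> c_on" and off: "0 \<le> c_off"
    using coherence_nonneg T_ge_1 \<beta>_nonneg by (simp_all add: c_on_def c_off_def)
  show "c_on < 1"
    using eq off small by linarith
qed

text \<open>Put \<open>g = z - x\<close>. Since columns have norm 1, \<open>d $ i\<close> is
  \<open>g i\<close> plus cross terms and noise. Hence \<open>x + d - z = d - g\<close> consists of
  cross terms and noise only, which coherence and \<open>\<epsilon>\<close> control.\<close>

lemma primal_dual_error:
  assumes x: "restricted_normal_eq \<Psi> y A x" and A: "A \<subseteq> supp z"
    and M: "\<And>i. i \<in> supp z - A \<Longrightarrow> \<bar>z $ i\<bar> \<le> M" and eM: "\<epsilon> \<le> \<beta> * M" and M0: "0 \<le> M"
    and d: "d = transpose \<Psi> *v (y - \<Psi> *v x)"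
  shows "i \<in> supp z \<Longrightarrow> \<bar>x $ i + d $ i - z $ i\<bar> \<le> c_on * M"
    and "i \<notin> supp z \<Longrightarrow> \<bar>x $ i + d $ i\<bar> \<le> c_off * M"
proof -
  let ?S = "supp z"
  let ?\<psi> = "\<lambda>i. column i \<Psi>"
  define g where "g j = z $ j - x $ j" for j
  have g0: "g j = 0" if "j \<notin> ?S" for j
    using that x A by (auto simp: g_def supp_def restricted_normal_eq_iff)
  have "y - \<Psi> *v x = \<Psi> *v (z - x) + (y - \<Psi> *v z)"
    by (simp add: matrix_vector_mult_diff_distrib)
  also have "\<Psi> *v (z - x) = (\<Sum>j\<in>?S. g j *\<^sub>R ?\<psi> j)"
    using g0 by (subst matrix_vector_mult_supported[where S = ?S]) (auto simp: g_def)
  finally have res: "y - \<Psi> *v x = (\<Sum>j\<in>?S. g j *\<^sub>R ?\<psi> j) + (y - \<Psi> *v z)" .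
  have d_eq: "d $ i = (\<Sum>j\<in>?S. g j * (?\<psi> i \<bullet> ?\<psi> j)) + ?\<psi> i \<bullet> (y - \<Psi> *v z)" for i
    unfolding d transpose_matrix_vector_nth res by (simp only: inner_add_right inner_sum_right inner_scaleR_right)
  \<comment> \<open>One bound serves both cases: off the support \<open>g i\<close> is 0 and
    deleting \<open>i\<close> from the sum changes nothing.\<close>
  have err: "\<bar>d $ i - g i\<bar> \<le> (\<Sum>j\<in>?S - {i}. \<bar>g j\<bar>) * \<nu> + \<epsilon>" for i
  proof -
    have "?\<psi> i \<bullet> ?\<psi> i = 1"
      using norm_column[of i] by (simp add: norm_eq_1)
    then have "(\<Sum>j\<in>?S. g j * (?\<psi> i \<bullet> ?\<psi> j)) = g i + (\<Sum>j\<in>?S - {i}. g j * (?\<psi> i \<bullet> ?\<psi> j))"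
      using g0 by (cases "i \<in> ?S") (simp_all add: sum.remove)
    then have eq: "d $ i - g i = (\<Sum>j\<in>?S - {i}. g j * (?\<psi> i \<bullet> ?\<psi> j)) + ?\<psi> i \<bullet> (y - \<Psi> *v z)"
      by (simp add: d_eq)
    have "\<bar>?\<psi> i \<bullet> (y - \<Psi> *v z)\<bar> \<le> norm (?\<psi> i) * norm (y - \<Psi> *v z)"
      by (rule Cauchy_Schwarz_ineq2)
    then have 1: "\<bar>?\<psi> i \<bullet> (y - \<Psi> *v z)\<bar> \<le> \<epsilon>"
      using noise by (simp add: norm_column)
    have "\<bar>\<Sum>j\<in>?S - {i}. g j * (?\<psi> i \<bullet> ?\<psi> j)\<bar> \<le> (\<Sum>j\<in>?S - {i}. \<bar>g j\<bar> * \<bar>?\<psi> i \<bullet> ?\<psi> j\<bar>)"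
      by (rule order.trans[OF sum_abs]) (simp add: abs_mult)
    also have "\<dots> \<le> (\<Sum>j\<in>?S - {i}. \<bar>g j\<bar> * \<nu>)"
      by (intro sum_mono mult_left_mono abs_inner_columns_le_coherence) auto
    finally show ?thesis
      using 1 unfolding eq by (simp add: sum_distrib_right)
  qed
  have err_on: "\<bar>d $ i - g i\<bar> \<le> (T - 1) * G * \<nu> + \<epsilon>"
    if "i \<in> ?S" "\<And>j. j \<in> ?S \<Longrightarrow> \<bar>g j\<bar> \<le> G" for i G
  proof -
    have "(\<Sum>j\<in>?S - {i}. \<bar>g j\<bar>) \<le> real (card (?S - {i})) * G"
      by (rule sum_bounded_above) (use that in auto)
    also have "real (card (?S - {i})) = T - 1"
      using that(1) T_ge_1 by (simp add: of_nat_diff)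
    finally show ?thesis
      using err[of i] mult_right_mono[OF _ coherence_nonneg] by fastforce
  qed
  text \<open>
    A largest entry of the error sits either off the active set, where it is bounded by
    assumption, or on it, where the normal equations bound it by a fraction of itself.
  \<close>
  have gM: "\<bar>g j\<bar> \<le> M" if "j \<in> ?S" for j
  proof -
    define G where "G = Max ((\<lambda>j. \<bar>g j\<bar>) ` ?S)"
    have G: "\<bar>g j\<bar> \<le> G" if "j \<in> ?S" for j
      unfolding G_def using that by (intro Max_ge) auto
    have "G \<in> (\<lambda>j. \<bar>g j\<bar>) ` ?S"
      unfolding G_def using supp_nonempty by (intro Max_in) auto
    then obtain i where i: "i \<in> ?S" "G = \<bar>g i\<bar>" by blast
    have "G \<le> M"
    proof (cases "i \<in> A")
      case True
      then have "d $ i = 0"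
        using x unfolding d transpose_matrix_vector_nth restricted_normal_eq_iff by blast
      then have *: "G \<le> (T - 1) * G * \<nu> + \<epsilon>"
        using err_on[OF i(1) G] i(2) by simp
      show ?thesis
      \<comment> \<open>If \<open>M < G\<close>, the noise bound \<open>\<beta> * M\<close> is at
        most \<open>\<beta> * G\<close>, and the estimate becomes \<open>G \<le> c_on * G\<close>.
        This is impossible for positive \<open>G\<close>, as \<open>c_on < 1\<close>.\<close>
      proof (rule ccontr)
        assume "\<not> G \<le> M"
        then have MG: "M < G" by simp
        then have "\<beta> * M \<le> \<beta> * G"
          using \<beta>_nonneg by (intro mult_left_mono) auto
        then have "G \<le> c_on * G"
          using * eM by (simp add: c_on_def algebra_simps)
        moreover have "c_on * G < 1 * G"
          by (rule mult_strict_right_mono) (use constants(4) MG M0 in auto)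
        ultimately show False by simp
      qed
    next
      case False
      then have "x $ i = 0"
        using x by (simp add: restricted_normal_eq_iff)
      then show ?thesis
        using M[of i] i False by (simp add: g_def)
    qed
    then show ?thesis
      using G[OF that] by linarith
  qed
  show "\<bar>x $ i + d $ i - z $ i\<bar> \<le> c_on * M" if "i \<in> ?S"
    using err_on[OF that gM] eM by (simp add: c_on_def g_def algebra_simps)
  show "\<bar>x $ i + d $ i\<bar> \<le> c_off * M" if "i \<notin> ?S"
  proof -
    have "(\<Sum>j\<in>?S - {i}. \<bar>g j\<bar>) \<le> T * M"
      using that by (auto intro!: sum_bounded_above gM)
    then have "\<bar>d $ i - g i\<bar> \<le> T * M * \<nu> + \<epsilon>"
      using err[of i] mult_right_mono[OF _ coherence_nonneg] by fastforce
    moreover have "x $ i = 0"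
      using that x A by (auto simp: restricted_normal_eq_iff)
    ultimately show ?thesis
      using g0[OF that] eM by (simp add: c_off_def algebra_simps)
  qed
qed

section \<open>The invariant and its behaviour in the inner loop\<close>

text \<open>The witness \<open>A\<close> is the set whose normal equations \<open>x\<close> solves;
  the active set computed from \<open>x\<close> and \<open>d\<close> is the one for the next step.
  Taking \<open>A = {}\<close> covers the initial pair.\<close>

definition good_iterate :: "real \<Rightarrow> real ^ 'p \<Rightarrow> real ^ 'p \<Rightarrow> bool" where
  "good_iterate M x d \<longleftrightarrow>
     (\<exists>A \<subseteq> supp z. restricted_normal_eq \<Psi> y A x \<and> d = transpose \<Psi> *v (y - \<Psi> *v x) \<and>
        (\<forall>i \<in> supp z - A. \<bar>z $ i\<bar> \<le> M))"

lemma good_iterate_mono: "good_iterate M x d \<Longrightarrow> M \<le> M' \<Longrightarrow> good_iterate M' x d"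
  unfolding good_iterate_def by (meson order.trans)

lemma good_iterate_stops:
  assumes "good_iterate M x d" and "\<And>i. i \<in> supp z \<Longrightarrow> M < \<bar>z $ i\<bar>"
  shows "pdasc_stop \<Psi> y \<epsilon> x"
proof -
  obtain A where A: "restricted_normal_eq \<Psi> y A x" "\<forall>i \<in> supp z - A. \<bar>z $ i\<bar> \<le> M"
    using assms(1) unfolding good_iterate_def by blast
  then have "supp z \<subseteq> A"
    using assms(2) by (force simp: not_le)
  from least_squares_residual_le[OF A(1) this] show ?thesis
    using noise unfolding pdasc_stop_def by linarith
qed

context
  fixes r s M l :: real
  assumes r: "c_on + c_off < r" "r < 1"
    and s: "s = sqrt (2 * l)"
    and M: "M = s / (r - c_on)" "\<epsilon> \<le> \<beta> * M" "0 \<le> M"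
begin

lemma threshold_eq: "s + c_on * M = r * M"
  using r constants(3) by (simp add: M(1) divide_simps algebra_simps)

lemma good_iterate_step:
  assumes "good_iterate M x d" and A': "A' = active_set l x d"
    and "restricted_normal_eq \<Psi> y A' x'" and "d' = transpose \<Psi> *v (y - \<Psi> *v x')"
  shows "good_iterate (r * M) x' d'"
proof -
  obtain A where A: "restricted_normal_eq \<Psi> y A x" "A \<subseteq> supp z"
    "\<And>i. i \<in> supp z - A \<Longrightarrow> \<bar>z $ i\<bar> \<le> M" "d = transpose \<Psi> *v (y - \<Psi> *v x)"
    using assms(1) unfolding good_iterate_def by blast
  note err = primal_dual_error[OF A(1-3) M(2,3) A(4)]
  \<comment> \<open>The lower bound on \<open>r\<close> enters here: off the support
    \<open>x + d\<close> cannot exceed the threshold \<open>s\<close>.\<close>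
  have "c_off * M \<le> (r - c_on) * M"
    using r M(3) by (intro mult_right_mono) auto
  then have "c_off * M \<le> s"
    using threshold_eq by (simp add: algebra_simps)
  then have "A' \<subseteq> supp z"
    using err(2) unfolding A' active_set_def s[symmetric] by fastforce
  moreover have "\<bar>z $ i\<bar> \<le> r * M" if "i \<in> supp z - A'" for i
    using that err(1)[of i] threshold_eq unfolding A' active_set_def s[symmetric] by auto
  ultimately show ?thesis
    using assms(3,4) unfolding good_iterate_def by blast
qed

text \<open>Each step turns the bound \<open>M\<close> into \<open>r * M\<close>, which is weakened
  back to \<open>M\<close> to feed the next step at the same threshold. The gain is one factor
  \<open>r\<close> per level, however many inner steps run.\<close>

lemma good_iterate_inner_loop:
  assumes "good_iterate M x0 d0" and "inner_loop \<Psi> y l J A0 x0 d0 x d"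
  shows "good_iterate (r * M) x d"
proof -
  obtain m :: nat and As xs ds where m: "1 \<le> m" "xs 0 = x0" "ds 0 = d0" "x = xs m" "d = ds m"
    and step: "\<And>j. j \<in> {1..m} \<Longrightarrow> As j = active_set l (xs (j - 1)) (ds (j - 1)) \<and>
           restricted_normal_eq \<Psi> y (As j) (xs j) \<and>
           ds j = transpose \<Psi> *v (y - \<Psi> *v xs j)"
    using assms(2) unfolding inner_loop_def by blast
  have rM: "r * M \<le> M"
    using r M(3) by (simp add: mult_left_le_one_le constants(2,3) add_nonneg_nonneg
        order.trans[OF _ less_imp_le[OF r(1)]])
  have step': "good_iterate (r * M) (xs (Suc j)) (ds (Suc j))"
    if "good_iterate M (xs j) (ds j)" "j < m" for j
    by (rule good_iterate_step[OF that(1), of "As (Suc j)"]) (use step[of "Suc j"] that(2) in auto)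
  have "good_iterate M (xs j) (ds j)" if "j \<le> m" for j
    using that
  proof (induction j)
    case 0
    then show ?case using assms(1) m by simp
  next
    case (Suc j)
    then show ?case using step'[of j] good_iterate_mono[OF _ rM] by simp
  qed
  \<comment> \<open>The last step is applied separately to keep the sharper bound; it exists because
    \<open>1 \<le> m\<close>.\<close>
  from step'[OF this, of "m - 1"] show ?thesis
    using m by simp
qed

end

text \<open>For \<open>x = 0\<close> and \<open>A = {}\<close>, the largest entry \<open>M\<close>
  of \<open>z\<close> differs from the matching entry of \<open>transpose \<Psi> *v y\<close> by at
  most \<open>c_on * M\<close>, so \<open>(1 - c_on) * M \<le> s\<close>. Since
  \<open>r < 1\<close>, also \<open>r - c_on \<le> r * (1 - c_on)\<close>, which turns this into the
  stated bound.\<close>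

lemma good_iterate_init:
  assumes "infnorm (transpose \<Psi> *v y) \<le> s" and "c_on + c_off < r" and "r < 1"
    and eps: "\<And>i. i \<in> supp z \<Longrightarrow> \<epsilon> \<le> \<beta> * \<bar>z $ i\<bar>"
  shows "good_iterate (r * (s / (r - c_on))) 0 (transpose \<Psi> *v y)"
    and "\<exists>i\<in>supp z. \<bar>z $ i\<bar> \<le> r * (s / (r - c_on))"
proof -
  define M where "M = Max ((\<lambda>i. \<bar>z $ i\<bar>) ` supp z)"
  have M: "\<bar>z $ i\<bar> \<le> M" if "i \<in> supp z" for i
    unfolding M_def using that by (intro Max_ge) auto
  have "M \<in> (\<lambda>i. \<bar>z $ i\<bar>) ` supp z"
    unfolding M_def using supp_nonempty by (intro Max_in) auto
  then obtain i where i: "i \<in> supp z" "M = \<bar>z $ i\<bar>" by blast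
  have 0: "restricted_normal_eq \<Psi> y {} 0"
    by (simp add: restricted_normal_eq_iff)
  have "\<bar>0 $ i + (transpose \<Psi> *v y) $ i - z $ i\<bar> \<le> c_on * M"
    by (rule primal_dual_error(1)[OF 0]) (use M i eps in auto)
  moreover have "\<bar>(transpose \<Psi> *v y) $ i\<bar> \<le> s"
    using component_le_infnorm_cart[of "transpose \<Psi> *v y" i] assms(1) by linarith
  ultimately have *: "M - c_on * M \<le> s"
    using i(2) by (simp add: zero_index)
  have "c_on * r \<le> c_on" "0 \<le> M"
    using assms(3) constants(2) i(2) by (simp_all add: mult_left_le)
  then have "M * (c_on * r) \<le> M * c_on"
    by (intro mult_left_mono)
  then have "M * (r - c_on) \<le> r * (M - c_on * M)"
    by (simp add: algebra_simps)
  also have "\<dots> \<le> r * s"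
    using * assms(2) constants(2,3) by (intro mult_left_mono) auto
  finally have Ms: "M \<le> r * (s / (r - c_on))"
    using assms(2) constants(3) by (simp add: pos_le_divide_eq)
  show "good_iterate (r * (s / (r - c_on))) 0 (transpose \<Psi> *v y)"
    unfolding good_iterate_def using 0 M Ms by (intro exI[of _ "{}"]) fastforce
  show "\<exists>i\<in>supp z. \<bar>z $ i\<bar> \<le> r * (s / (r - c_on))"
    using i Ms by auto
qed

section \<open>Geometric decay over the outer loop and termination\<close>

theorem pdasc_terminates:
  assumes \<rho>: "((2 * T - 1) * \<nu> + 2 * \<beta>)\<^sup>2 < \<rho>" "\<rho> < 1"
    and eps: "\<And>i. i \<in> supp z \<Longrightarrow> \<epsilon> \<le> \<beta> * \<bar>z $ i\<bar>"
    and lam0: "1 / 2 * (infnorm (transpose \<Psi> *v y))\<^sup>2 \<le> lam0"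
    and run: "pdasc_run \<Psi> y \<epsilon> lam0 \<rho> J lam A x d"
  shows "\<exists>k\<ge>1. pdasc_stop \<Psi> y \<epsilon> (x k)"
proof (rule ccontr)
  assume "\<not> ?thesis"
  then have nostop: "\<not> pdasc_stop \<Psi> y \<epsilon> (x k)" if "1 \<le> k" for k
    using that by blast
  define r where "r = sqrt \<rho>"
  have r: "c_on + c_off < r" "r < 1"
    using \<rho> real_less_rsqrt[of "c_on + c_off" \<rho>] unfolding r_def by (simp_all add: constants(1))
  have rpos: "0 < r" "0 < r - c_on"
    using r constants by linarith+
  define s where "s k = sqrt (2 * lam k)" for k
  have start: "lam 0 = lam0" "x 0 = 0" "d 0 = transpose \<Psi> *v y"
    using run unfolding pdasc_run_def by auto
  \<comment> \<open>Without a stop every level is carried out, so the recursion of the run holds for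
    all \<open>k\<close>.\<close>
  have level: "lam (Suc k) = \<rho> * lam k"
    "inner_loop \<Psi> y (lam (Suc k)) J (A k) (x k) (d k) (x (Suc k)) (d (Suc k))" for k
    using run nostop unfolding pdasc_run_def by (auto dest!: spec[of _ "Suc k"])
  have s_Suc: "s (Suc k) = r * s k" for k
    by (simp add: s_def r_def level(1) real_sqrt_mult mult.left_commute)
  have s_eq: "s k = s 0 * r ^ k" for k
    by (induction k) (simp_all add: s_Suc)
  have "(infnorm (transpose \<Psi> *v y))\<^sup>2 \<le> 2 * lam 0"
    using lam0 start by simp
  then have s0: "infnorm (transpose \<Psi> *v y) \<le> s 0"
    unfolding s_def by (rule real_le_rsqrt)
  then have s_nonneg: "0 \<le> s k" for k
    using infnorm_pos_le[of "transpose \<Psi> *v y"] rpos by (simp add: s_eq[of k])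
  define M where "M k = s k / (r - c_on)" for k
  have M_Suc: "M (Suc k) = r * M k" and M_nonneg: "0 \<le> M k" for k
    using rpos s_nonneg[of k] by (simp_all add: M_def s_Suc)
  \<comment> \<open>The second conjunct says that some support entry is still small; otherwise the
    run would have stopped. It yields \<open>\<epsilon> \<le> \<beta> * M (Suc k)\<close>, which the
    next inner loop requires.\<close>
  have inv: "good_iterate (r * M k) (x k) (d k) \<and> (\<exists>i\<in>supp z. \<bar>z $ i\<bar> \<le> r * M k)" for k
  proof (induction k)
    case 0
    then show ?case
      using good_iterate_init[OF s0 r eps] by (simp add: M_def start)
  next
    case (Suc k)
    then obtain i where i: "i \<in> supp z" "\<bar>z $ i\<bar> \<le> M (Suc k)"
      by (auto simp: M_Suc)
    have "\<epsilon> \<le> \<beta> * M (Suc k)"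
      using eps[OF i(1)] mult_left_mono[OF i(2) \<beta>_nonneg] by linarith
    from good_iterate_inner_loop[OF r s_def M_def this M_nonneg _ level(2)]
    have good: "good_iterate (r * M (Suc k)) (x (Suc k)) (d (Suc k))"
      using Suc by (simp add: M_Suc)
    have "\<exists>i\<in>supp z. \<bar>z $ i\<bar> \<le> r * M (Suc k)"
      using good_iterate_stops[OF good] nostop[of "Suc k"] by force
    with good show ?case by blast
  qed
  \<comment> \<open>The smallest modulus on the support is positive, yet the invariant keeps it
    below a sequence tending to 0.\<close>
  define \<mu> where "\<mu> = Min ((\<lambda>i. \<bar>z $ i\<bar>) ` supp z)"
  have "\<mu> \<in> (\<lambda>i. \<bar>z $ i\<bar>) ` supp z"
    unfolding \<mu>_def using supp_nonempty by (intro Min_in) auto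
  then have "0 < \<mu>"
    by (auto simp: supp_def)
  have "\<mu> \<le> M (Suc k)" for k
    using inv[of k] unfolding \<mu>_def M_Suc by (fastforce intro: order.trans[OF Min_le])
  moreover have "(\<lambda>k. M (Suc k)) \<longlonglongrightarrow> 0"
  proof -
    have "(\<lambda>k. r ^ Suc k) \<longlonglongrightarrow> 0"
      using rpos r by (intro LIMSEQ_Suc LIMSEQ_realpow_zero) auto
    then have "(\<lambda>k. s 0 / (r - c_on) * r ^ Suc k) \<longlonglongrightarrow> s 0 / (r - c_on) * 0"
      by (rule tendsto_mult_left)
    moreover have "M (Suc k) = s 0 / (r - c_on) * r ^ Suc k" for k
      unfolding M_def by (subst s_eq) simp
    ultimately show ?thesis
      by simp
  qed
  ultimately have "\<mu> \<le> 0"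
    by (intro LIMSEQ_le_const) auto
  with \<open>0 < \<mu>\<close> show False by simp
qed

end

theorem theorem3p1:
  fixes \<Psi> :: "real ^ 'p ^ 'n"
    and xstar :: "real ^ 'p"
    and \<eta> y :: "real ^ 'n"
    and \<epsilon> \<beta> \<rho> lam0 :: real
    and T Jmax :: nat
    and lam :: "nat \<Rightarrow> real"
    and A :: "nat \<Rightarrow> 'p set"
    and x d :: "nat \<Rightarrow> real ^ 'p"
  assumes "CARD('p) > CARD('n)"
    and "\<And>i. norm (column i \<Psi>) = 1"
    and "T = card (supp xstar)" and "T \<ge> 1"
    and "y = (\<Sum>i\<in>supp xstar. xstar $ i *\<^sub>R column i \<Psi>) + \<eta>"
    and "\<epsilon> \<ge> 0" and "norm \<eta> \<le> \<epsilon>"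
    and "0 \<le> \<beta>" and "\<beta> < 1 / 2"
    and "\<epsilon> \<le> \<beta> * Min ((\<lambda>i. \<bar>xstar $ i\<bar>) ` supp xstar)"
    and "mutual_coherence \<Psi> < (1 - 2 * \<beta>) / (2 * real T - 1)"
    and "((2 * real T - 1) * mutual_coherence \<Psi> + 2 * \<beta>)\<^sup>2 < \<rho>" and "\<rho> < 1"
    and "lam0 \<ge> 1 / 2 * (infnorm (transpose \<Psi> *v y))\<^sup>2"
    and "Jmax \<ge> 1"
    and "pdasc_run \<Psi> y \<epsilon> lam0 \<rho> Jmax lam A x d"
  shows "\<exists>k\<ge>1. pdasc_stop \<Psi> y \<epsilon> (x k)"
proof -
  have supp: "supp xstar \<noteq> {}"
    using assms(3,4) by auto
  have "y - \<Psi> *v xstar = \<eta>"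
    by (subst matrix_vector_mult_supported[where S = "supp xstar"]) (auto simp: assms(5) supp_def)
  moreover have "0 < 2 * real T - 1"
    using assms(4) by linarith
  then have "(2 * real T - 1) * mutual_coherence \<Psi> + 2 * \<beta> < 1"
    using assms(11) by (simp add: pos_less_divide_eq mult.commute)
  \<comment> \<open>There are more columns than rows and at least one row, hence at least two
    columns.\<close>
  moreover have "CARD('p) > 1"
    using assms(1) zero_less_card_finite[where 'a = 'n] by linarith
  ultimately interpret coherent_recovery \<Psi> xstar y \<epsilon> \<beta>
    using assms(2,3,7,8) supp by unfold_locales auto
  have "\<epsilon> \<le> \<beta> * \<bar>xstar $ i\<bar>" if "i \<in> supp xstar" for i
  proof -
    have "Min ((\<lambda>i. \<bar>xstar $ i\<bar>) ` supp xstar) \<le> \<bar>xstar $ i\<bar>"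
      using that by (intro Min_le) auto
    then show ?thesis
      using assms(10) mult_left_mono[OF _ assms(8)] by fastforce
  qed
  then show ?thesis
    using pdasc_terminates[OF _ assms(13) _ assms(14,16)] assms(3,12) by simp
qed

end
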